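(* Let $M$ be a finitely generated right module over the free group algebra $R=\mathcal{F}_r=\Phi F_r$, $r>1$, over a field $\Phi$, with growth function $g(n)$ (with respect to a finite generating set). If the function $\dfrac{(2r-1)^n}{g(n)}$ is subexponential, then $M$ is a faithful $R$-module. In particular, any $R$-module of maximal growth is faithful.
   Context: A right $R$-module $M$ is faithful if $\mathrm{Ann}_RM=\{a\in R : Ma=0\}$ is zero. A function $f$ on $\mathbb{N}$ with positive values is subexponential if $\limsup_{n\to\infty}\sqrt[n]{f(n)}\le1$. $F_r$ is the free group with a fixed free basis $X$ of $r$ elements ($r$ finite); $R(n)$ is the span in $R$ of the elements of $F_r$ of reduced length at most $n$ in $X\cup X^{-1}$. For a module $M$ generated by a finite set $A$ the growth function is $g(n)=g_{A,M}(n)=\dim_\Phi(AR(n))$. Functions $f,g$ are equivalent if for some nonnegative integers $C,C'$ one has $f(n)\le g(n+C)$ and $g(n)\le f(n+C')$ for all $n\ge0$. A finitely generated module has maximal growth if its growth function is equivalent to that of the free module of rank 1, i.e. to $(2r-1)^n$ (independently of the finite generating set); an arbitrary module has maximal growth if it contains a finitely generated submodule of maximal growth. *)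

theory Defs
  imports Complex_Main "HOL-Library.Cardinality" "HOL-Library.Extended_Real"
    "HOL-Library.Poly_Mapping"
begin

text \<open>A letter is a generator together with a sign: \<open>(x, True)\<close> stands for \<open>x\<close> and
  \<open>(x, False)\<close> for its inverse. The elements of the free group are the reduced words.\<close>

type_synonym 'x letter = "'x \<times> bool"

definition inv_letter :: "'x letter \<Rightarrow> 'x letter" where
  "inv_letter a = (fst a, \<not> snd a)"

definition reduced :: "'x letter list \<Rightarrow> bool" where
  "reduced = successively (\<lambda>a b. b \<noteq> inv_letter a)"

fun push :: "'x letter \<Rightarrow> 'x letter list \<Rightarrow> 'x letter list" where
  "push a [] = [a]"
| "push a (b # w) = (if b = inv_letter a then w else a # b # w)"

lemma inv_letter_inv_letter [simp]: "inv_letter (inv_letter a) = a"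
  by (simp add: inv_letter_def)

lemma inv_letter_neq [simp]: "inv_letter a \<noteq> a" "a \<noteq> inv_letter a"
  by (simp_all add: inv_letter_def prod_eq_iff)

lemma reduced_Nil [simp]: "reduced []"
  by (simp add: reduced_def)

lemma reduced_Cons:
  "reduced (a # w) \<longleftrightarrow> w = [] \<or> hd w \<noteq> inv_letter a \<and> reduced w"
  by (cases w) (auto simp: reduced_def)

lemma reduced_push: "reduced w \<Longrightarrow> reduced (push a w)"
  by (cases w) (auto simp: reduced_Cons)

lemma push_inv: "reduced w \<Longrightarrow> push (inv_letter a) (push a w) = w"
  by (cases w; cases "tl w") (auto simp: reduced_Cons)

lemma push_inv': "reduced w \<Longrightarrow> push a (push (inv_letter a) w) = w"
  using push_inv[of w "inv_letter a"] by simp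

lemma reduced_foldr_push: "reduced w \<Longrightarrow> reduced (foldr push u w)"
  by (induction u) (auto intro: reduced_push)

lemma push_foldr:
  assumes "reduced v" "reduced w"
  shows "foldr push (push a v) w = push a (foldr push v w)"
proof (cases v)
  case (Cons b v')
  then show ?thesis
    using assms push_inv'[of "foldr push v' w" a] by (auto simp: reduced_foldr_push)
qed simp

lemma foldr_push_assoc:
  assumes "reduced v" "reduced w"
  shows "foldr push (foldr push u v) w = foldr push u (foldr push v w)"
  using assms by (induction u) (auto simp: push_foldr reduced_foldr_push)

lemma foldr_push_Nil: "reduced w \<Longrightarrow> foldr push w [] = w"
proof (induction w)
  case (Cons a w)
  then show ?case by (cases w) (auto simp: reduced_Cons)
qed simp

lemma foldr_push_inverse: "foldr push (rev (map inv_letter w)) w = []"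
proof -
  have "foldr push (rev (map inv_letter w)) (w @ v) = v" for v
    by (induction w arbitrary: v) auto
  from this[of "[]"] show ?thesis by simp
qed

lemma reduced_inverse: "reduced w \<Longrightarrow> reduced (rev (map inv_letter w))"
  unfolding reduced_def
  by (auto simp: successively_rev successively_map intro: successively_mono)

typedef 'x free_group = "{w :: 'x letter list. reduced w}"
  morphisms word_of Abs_free_group
  by (rule exI[of _ "[]"]) simp

setup_lifting type_definition_free_group

text \<open>The free group is written additively, as a (noncommutative) \<open>group_add\<close>: the convolution
  product of \<^theory>\<open>HOL-Library.Poly_Mapping\<close> is defined for additively written monoids.\<close>

instantiation free_group :: (type) group_add
begin

lift_definition zero_free_group :: "'a free_group" is "[]" by simp

lift_definition plus_free_group :: "'a free_group \<Rightarrow> 'a free_group \<Rightarrow> 'a free_group"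
  is "foldr push" by (rule reduced_foldr_push)

lift_definition uminus_free_group :: "'a free_group \<Rightarrow> 'a free_group"
  is "\<lambda>w. rev (map inv_letter w)" by (rule reduced_inverse)

definition minus_free_group :: "'a free_group \<Rightarrow> 'a free_group \<Rightarrow> 'a free_group" where
  "minus_free_group g h = g + - h"

instance
proof
  fix a b c :: "'a free_group"
  show "a + b + c = a + (b + c)" by transfer (rule foldr_push_assoc)
  show "0 + a = a" by transfer simp
  show "a + 0 = a" by transfer (rule foldr_push_Nil)
  show "- a + a = 0" by transfer (rule foldr_push_inverse)
  show "a + - b = a - b" by (simp add: minus_free_group_def)
qed

end

definition word_length :: "'x free_group \<Rightarrow> nat" where
  "word_length g = length (word_of g)"

locale right_module =
  fixes act :: "'m::ab_group_add \<Rightarrow> 'r::ring_1 \<Rightarrow> 'm"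
  assumes act_add_left: "act (m + m') a = act m a + act m' a"
    and act_add_right: "act m (a + b) = act m a + act m b"
    and act_mult: "act m (a * b) = act (act m a) b"
    and act_one: "act m 1 = m"

definition right_submodule :: "('m::ab_group_add \<Rightarrow> 'r::ring_1 \<Rightarrow> 'm) \<Rightarrow> 'm set \<Rightarrow> bool" where
  "right_submodule act N \<longleftrightarrow>
     0 \<in> N \<and> (\<forall>m\<in>N. \<forall>m'\<in>N. m + m' \<in> N) \<and> (\<forall>m\<in>N. \<forall>a. act m a \<in> N)"

definition generates :: "('m::ab_group_add \<Rightarrow> 'r::ring_1 \<Rightarrow> 'm) \<Rightarrow> 'm set \<Rightarrow> 'm set \<Rightarrow> bool" where
  "generates act A N \<longleftrightarrow> right_submodule act hull A = N"

definition annihilator :: "('m::ab_group_add \<Rightarrow> 'r::ring_1 \<Rightarrow> 'm) \<Rightarrow> 'r set" where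
  "annihilator act = {a. \<forall>m. act m a = 0}"

definition faithful :: "('m::ab_group_add \<Rightarrow> 'r::ring_1 \<Rightarrow> 'm) \<Rightarrow> bool" where
  "faithful act \<longleftrightarrow> annihilator act = {0}"

text \<open>In \<^typ>\<open>'x free_group \<Rightarrow>\<^sub>0 'k\<close> the product is convolution, the basis element of a group
  element \<open>g\<close> is \<open>Poly_Mapping.single g 1\<close>, and \<open>c\<close> in the field is
  identified with \<open>Poly_Mapping.single 0 c\<close>.\<close>

type_synonym ('x, 'k) free_group_algebra = "'x free_group \<Rightarrow>\<^sub>0 'k"

definition scalar ::
  "('m::ab_group_add \<Rightarrow> ('x, 'k::field) free_group_algebra \<Rightarrow> 'm) \<Rightarrow> 'k \<Rightarrow> 'm \<Rightarrow> 'm" where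
  "scalar act c m = act m (Poly_Mapping.single 0 c)"

lemma vector_space_scalar:
  fixes act :: "'m::ab_group_add \<Rightarrow> ('x, 'k::field) free_group_algebra \<Rightarrow> 'm"
  assumes "right_module act"
  shows "vector_space (scalar act)"
proof -
  interpret right_module act by fact
  show ?thesis
    by unfold_locales
      (simp_all add: scalar_def act_add_left act_add_right single_add act_one
        flip: act_mult mult_single, simp_all add: mult_single mult.commute act_one)
qed

lemma right_module_regular: "right_module ((*) :: 'r::ring_1 \<Rightarrow> 'r \<Rightarrow> 'r)"
  by unfold_locales (simp_all add: algebra_simps)

text \<open>The span of the group elements of reduced length at most \<open>n\<close>; the group algebra is
  a vector space through its regular right module structure \<open>(*)\<close>.\<close>

definition ball_span :: "nat \<Rightarrow> ('x, 'k::field) free_group_algebra set" where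
  "ball_span n = module.span (scalar (*)) {Poly_Mapping.single g 1 | g. word_length g \<le> n}"

definition growth ::
  "('m::ab_group_add \<Rightarrow> ('x, 'k::field) free_group_algebra \<Rightarrow> 'm) \<Rightarrow> 'm set \<Rightarrow> nat \<Rightarrow> nat" where
  "growth act A n =
     vector_space.dim (scalar act)
       (module.span (scalar act) {act m a | m a. m \<in> A \<and> a \<in> ball_span n})"

text \<open>Positivity matters: for the zero module \<open>growth act A n = 0\<close>, and division by zero in HOL
  would otherwise make every quotient by it subexponential.\<close>

definition subexponential :: "(nat \<Rightarrow> real) \<Rightarrow> bool" where
  "subexponential f \<longleftrightarrow>
     (\<forall>n. f n > 0) \<and> limsup (\<lambda>n. ereal (root n (f n))) \<le> 1"

definition growth_equiv :: "(nat \<Rightarrow> nat) \<Rightarrow> (nat \<Rightarrow> nat) \<Rightarrow> bool" where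
  "growth_equiv f g \<longleftrightarrow> (\<exists>C C'. \<forall>n. f n \<le> g (n + C) \<and> g n \<le> f (n + C'))"

text \<open>The regular module with the generating set \<open>{1}\<close> is the free module of rank 1. Up to
  equivalence the growth function does not depend on the choice of the finite generating set
  \<open>A\<close>, so it is enough to ask for one.\<close>

definition fg_maximal_growth ::
  "('m::ab_group_add \<Rightarrow> ('x, 'k::field) free_group_algebra \<Rightarrow> 'm) \<Rightarrow> 'm set \<Rightarrow> bool" where
  "fg_maximal_growth act N \<longleftrightarrow>
     (\<exists>A. finite A \<and> generates act A N \<and>
        growth_equiv (growth act A)
          (growth ((*) :: ('x, 'k) free_group_algebra \<Rightarrow> _ \<Rightarrow> _) {1}))"

definition maximal_growth ::
  "('m::ab_group_add \<Rightarrow> ('x, 'k::field) free_group_algebra \<Rightarrow> 'm) \<Rightarrow> bool" where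
  "maximal_growth act \<longleftrightarrow> (\<exists>N. right_submodule act N \<and> fg_maximal_growth act N)"

end

theory Submission
  imports Defs "HOL-Library.Sublist"
begin

text \<open>If \<open>M a = 0\<close> with \<open>a \<noteq> 0\<close>, let \<open>u\<close> be the leading word of \<open>a\<close> in the length-lexicographic
  order. It stays leading in every translate \<open>p a q\<close> for which \<open>p u q\<close> is reduced, because
  cancellation only shortens words. As \<open>p a q\<close> also annihilates \<open>M\<close>, words containing \<open>u\<close> can be
  rewritten, so the growth of \<open>M\<close> is at most a constant times the number of reduced words of
  length at most \<open>n\<close> that avoid \<open>u\<close>. The latter is \<open>O(x\<^sup>n)\<close> for some \<open>x < 2 r - 1\<close>, contrary to the
  growth hypothesis.\<close>

section \<open>Cancellation in products of reduced words\<close>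

lemma length_foldr_push_le: "length (foldr push u w) \<le> length u + length w"
proof (induction u)
  case (Cons a u)
  then show ?case by (cases "foldr push u w") (auto split: if_splits)
qed simp

text \<open>Every cancellation makes the product shorter than the concatenation, so full length
  means that none took place.\<close>

lemma foldr_push_eq_append:
  "length (foldr push u w) = length u + length w \<Longrightarrow> foldr push u w = u @ w"
proof (induction u)
  case (Cons a u)
  then show ?case
    using length_foldr_push_le[of u w]
    by (cases "foldr push u w") (auto split: if_splits)
qed simp

lemma foldr_push_reduced: "reduced (u @ w) \<Longrightarrow> foldr push u w = u @ w"
proof (induction u)
  case (Cons a u)
  then show ?case by (cases "u @ w") (auto simp: reduced_Cons)
qed simp

lemma reduced_append_iff:
  "reduced (u @ w) \<longleftrightarrow>
     reduced u \<and> reduced w \<and> (u = [] \<or> w = [] \<or> hd w \<noteq> inv_letter (last u))"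
  by (auto simp: reduced_def successively_append_iff)

lemma word_of_add: "word_of (g + h) = foldr push (word_of g) (word_of h)"
  by (rule plus_free_group.rep_eq)

lemma word_of_Abs: "reduced w \<Longrightarrow> word_of (Abs_free_group w) = w"
  by (simp add: Abs_free_group_inverse)

lemma reduced_word_of [simp]: "reduced (word_of g)"
  using word_of by auto

text \<open>Without cancellation the product is the concatenation, and the order is compatible with
  a common prefix and suffix. With cancellation the product is strictly shorter, hence smaller,
  since \<open>lenlex\<close> compares lengths first.\<close>

lemma word_of_add3_less:
  assumes less: "(word_of g, u) \<in> lenlex R" and irr: "irrefl R"
  shows "(word_of (p + g + q), word_of p @ u @ word_of q) \<in> lenlex R"
proof -
  let ?P = "word_of p" and ?G = "word_of g" and ?Q = "word_of q"
  let ?W = "foldr push ?P (foldr push ?G ?Q)"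
  have W: "word_of (p + g + q) = ?W"
    by (simp add: word_of_add add.assoc)
  have app: "(?P @ ?G @ ?Q, ?P @ u @ ?Q) \<in> lenlex R"
    using less irr by (simp add: lenlex_append1)
  have le: "length (foldr push ?G ?Q) \<le> length ?G + length ?Q"
    "length ?W \<le> length ?P + length (foldr push ?G ?Q)"
    by (rule length_foldr_push_le)+
  show ?thesis
  proof (cases "length ?W = length ?P + length ?G + length ?Q")
    case True
    then have "?W = ?P @ ?G @ ?Q"
      using foldr_push_eq_append[of ?P "foldr push ?G ?Q"] foldr_push_eq_append[of ?G ?Q] le
      by auto
    then show ?thesis using app W by simp
  next
    case False
    then show ?thesis
      using le lenlex_length[OF less] W by (auto simp: lenlex_conv)
  qed
qed

subsection \<open>Counting reduced words\<close>

lemma card_letters: "CARD('x::finite letter) = 2 * CARD('x)"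
  by (simp add: card_UNIV_bool)

lemma finite_reduced_extensions: "finite {z :: 'x::finite letter list. length z = n \<and> P z}"
  by (rule finite_subset[OF _ finite_lists_length_eq[of UNIV n]]) auto

text \<open>Each new letter may be anything but the inverse of its predecessor. As \<open>p\<close>
  is nonempty, this holds for the first new letter too. The induction varies \<open>p\<close>, which
  absorbs that letter.\<close>

lemma card_reduced_extensions:
  fixes p :: "'x::finite letter list"
  assumes "p \<noteq> []" "reduced p"
  shows "card {z. length z = n \<and> reduced (p @ z)} = (2 * CARD('x) - 1) ^ n"
  using assms
proof (induction n arbitrary: p)
  case 0
  then have "{z. length z = 0 \<and> reduced (p @ z)} = {[]}" by auto
  then show ?case by simp
next
  case (Suc n)
  let ?E = "\<lambda>a. {z. length z = n \<and> reduced ((p @ [a]) @ z)}"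
  let ?A = "- {inv_letter (last p)}"
  have red: "reduced (p @ [a])" if "a \<in> ?A" for a
    using that Suc.prems by (auto simp: reduced_append_iff reduced_Cons)
  have "{z. length z = Suc n \<and> reduced (p @ z)} = (\<Union>a\<in>?A. (#) a ` ?E a)"
    using Suc.prems by (auto simp: length_Suc_conv reduced_append_iff reduced_Cons)
  also have "card \<dots> = (\<Sum>a\<in>?A. card ((#) a ` ?E a))"
    by (rule card_UN_disjoint) (auto intro: finite_reduced_extensions)
  also have "\<dots> = (\<Sum>a\<in>?A. (2 * CARD('x) - 1) ^ n)"
    by (intro sum.cong refl, subst card_image) (use Suc.IH[OF _ red] in auto)
  also have "card ?A = 2 * CARD('x) - 1"
    by (simp add: Compl_eq_Diff_UNIV card_Diff_singleton card_letters del: card_prod)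
  then have "(\<Sum>a\<in>?A. (2 * CARD('x) - 1) ^ n) = (2 * CARD('x) - 1) ^ Suc n"
    by simp
  finally show ?case .
qed

text \<open>Words that can follow a fixed letter \<open>a\<close> without cancellation are reduced,
  and there are exactly \<open>(2 r - 1) ^ n\<close> of them.\<close>

lemma card_reduced_words_ge:
  "(2 * CARD('x::finite) - 1) ^ n \<le> card {w :: 'x letter list. length w = n \<and> reduced w}"
proof -
  fix a :: "'x letter"
  have "card {w. length w = n \<and> reduced ([a] @ w)} \<le> card {w :: 'x letter list. length w = n \<and> reduced w}"
    by (intro card_mono finite_reduced_extensions) (auto simp: reduced_Cons)
  then show ?thesis
    by (subst (asm) card_reduced_extensions) (auto simp: reduced_Cons)
qed

text \<open>\<open>sublist\<close> is the relation of contiguous factors, which matches the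
  rewriting of words \<open>P @ u @ Q\<close>.\<close>

definition avoiding :: "'x letter list \<Rightarrow> nat \<Rightarrow> 'x letter list set" where
  "avoiding u n = {w. length w = n \<and> reduced w \<and> \<not> sublist u w}"

lemma finite_avoiding [simp]: "finite (avoiding (u :: 'x::finite letter list) n)"
  unfolding avoiding_def by (rule finite_reduced_extensions)

text \<open>Every reduced word of positive length can be continued by \<open>c # u\<close> for some letter \<open>c\<close>,
  so at least one of its continuations by \<open>Suc (length u)\<close> letters is lost.\<close>

lemma card_avoiding_step:
  fixes u :: "'x::finite letter list"
  assumes "CARD('x) > 1" "reduced u" "n > 0"
  shows "card (avoiding u (n + Suc (length u)))
           \<le> card (avoiding u n) * ((2 * CARD('x) - 1) ^ Suc (length u) - 1)"
proof -
  let ?K = "Suc (length u)"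
  define E where "E p = {z. length z = ?K \<and> reduced (p @ z) \<and> \<not> sublist u z}"
    for p :: "'x letter list"
  have "card (E p) \<le> (2 * CARD('x) - 1) ^ ?K - 1" if p: "p \<in> avoiding u n" for p
  proof -
    have p': "p \<noteq> []" "reduced p" using p assms by (auto simp: avoiding_def)
    \<comment> \<open>Two letters at most are forbidden and there are at least four. For empty
      \<open>u\<close> the letter \<open>hd u\<close> is merely unspecified, which does no
      harm.\<close>
    have "\<exists>c. c \<notin> {inv_letter (last p), inv_letter (hd u)}"
    proof (rule ccontr)
      assume "\<not> ?thesis"
      then have "(UNIV :: 'x letter set) \<subseteq> {inv_letter (last p), inv_letter (hd u)}" by blast
      then have "CARD('x letter) \<le> card {inv_letter (last p), inv_letter (hd u)}"
        by (intro card_mono) auto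
      also have "\<dots> \<le> 2" by (simp add: card_insert_if)
      finally show False using assms(1) card_letters[where 'x='x] by simp
    qed
    then obtain c where c: "c \<noteq> inv_letter (last p)" "c \<noteq> inv_letter (hd u)" by auto
    then have "hd u \<noteq> inv_letter c" by auto
    then have cu: "reduced (p @ c # u)"
      using c p' assms(2) by (auto simp: reduced_append_iff reduced_Cons)
    have "E p \<subseteq> {z. length z = ?K \<and> reduced (p @ z)} - {c # u}"
      by (auto simp: E_def sublist_Cons_right)
    then have "card (E p) \<le> card ({z. length z = ?K \<and> reduced (p @ z)} - {c # u})"
      by (intro card_mono finite_Diff finite_reduced_extensions)
    also have "\<dots> = (2 * CARD('x) - 1) ^ ?K - 1"
      using cu by (subst card_Diff_singleton) (auto simp only: card_reduced_extensions[OF p'], simp)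
    finally show ?thesis .
  qed note E_le = this
  \<comment> \<open>Both pieces of a word cut after \<open>n\<close> letters avoid \<open>u\<close>.
    Occurrences of \<open>u\<close> across the cut are ignored, which can only enlarge the
    union.\<close>
  have "w \<in> (\<Union>p\<in>avoiding u n. (@) p ` E p)" if "w \<in> avoiding u (n + ?K)" for w
  proof -
    have w: "length w = n + ?K" "reduced w" "\<not> sublist u w"
      using that by (auto simp: avoiding_def)
    have "\<not> sublist u (take n w)" "\<not> sublist u (drop n w)"
      using w(3) by (blast intro: sublist_order.order_trans sublist_take sublist_drop)+
    moreover have "reduced (take n w)"
      using w(2) by (metis append_take_drop_id reduced_append_iff)
    ultimately have "take n w \<in> avoiding u n" "drop n w \<in> E (take n w)"
      using w by (auto simp: avoiding_def E_def)
    then show ?thesis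
      by (intro UN_I[of "take n w"] image_eqI[of _ _ "drop n w"]) simp_all
  qed
  then have "avoiding u (n + ?K) \<subseteq> (\<Union>p\<in>avoiding u n. (@) p ` E p)" by (rule subsetI)
  then have "card (avoiding u (n + ?K)) \<le> card (\<Union>p\<in>avoiding u n. (@) p ` E p)"
    by (rule card_mono[rotated]) (auto simp: E_def intro!: finite_reduced_extensions)
  also have "\<dots> \<le> (\<Sum>p\<in>avoiding u n. card ((@) p ` E p))"
    by (rule card_UN_le) simp
  also have "\<dots> \<le> (\<Sum>p\<in>avoiding u n. (2 * CARD('x) - 1) ^ ?K - 1)"
  proof (rule sum_mono)
    fix p assume "p \<in> avoiding u n"
    have "card ((@) p ` E p) = card (E p)"
      by (rule card_image) (auto simp: inj_on_def)
    then show "card ((@) p ` E p) \<le> (2 * CARD('x) - 1) ^ ?K - 1"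
      using E_le[OF \<open>p \<in> avoiding u n\<close>] by simp
  qed
  also have "\<dots> = card (avoiding u n) * ((2 * CARD('x) - 1) ^ ?K - 1)" by simp
  finally show ?thesis .
qed

lemma geometric_bound_of_step:
  fixes f :: "nat \<Rightarrow> real"
  assumes nonneg: "\<And>n. f n \<ge> 0" and "K > 0" and "x \<ge> 1"
    and step: "\<And>n. n > 0 \<Longrightarrow> f (n + K) \<le> f n * x ^ K"
  shows "f n \<le> (\<Sum>k\<le>K. f k) * x ^ n"
proof (induction n rule: less_induct)
  case (less n)
  show ?case
  proof (cases "n \<le> K")
    case True
    then have "f n \<le> (\<Sum>k\<le>K. f k)"
      using nonneg by (intro member_le_sum) auto
    also have "\<dots> \<le> (\<Sum>k\<le>K. f k) * x ^ n"
      using mult_left_mono[of 1 "x ^ n" "\<Sum>k\<le>K. f k"] assms by (simp add: sum_nonneg)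
    finally show ?thesis .
  next
    case False
    then have "f n \<le> f (n - K) * x ^ K" using step[of "n - K"] by simp
    also have "\<dots> \<le> (\<Sum>k\<le>K. f k) * x ^ (n - K) * x ^ K"
      using less.IH[of "n - K"] False assms by (intro mult_right_mono) auto
    also have "\<dots> = (\<Sum>k\<le>K. f k) * x ^ n"
      using False by (simp flip: power_add add: mult.assoc)
    finally show ?thesis .
  qed
qed

text \<open>Losing one continuation in each block of \<open>K = Suc (length u)\<close> letters
  lowers the rate from \<open>q = 2 r - 1\<close> to the \<open>K\<close>-th root of
  \<open>q ^ K - 1\<close>. As this rate exceeds 1, summing over all lengths up to \<open>n\<close>
  costs only a constant factor.\<close>

lemma card_avoiding_bound:
  fixes u :: "'x::finite letter list"
  assumes "CARD('x) > 1" "reduced u"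
  obtains C x :: real where "C > 0" "1 < x" "x < 2 * real CARD('x) - 1"
    "\<And>n. card (\<Union>k\<le>n. avoiding u k) \<le> C * x ^ n"
proof -
  let ?K = "Suc (length u)"
  define q :: real where "q = 2 * real CARD('x) - 1"
  have q: "q \<ge> 3" using assms(1) by (simp add: q_def)
  have q1: "1 \<le> 2 * CARD('x) - 1" using assms(1) by simp
  have q_nat: "real (2 * CARD('x) - 1) = q" by (simp add: q_def of_nat_diff)
  define x where "x = root ?K (q ^ ?K - 1)"
  have "q ^ 1 \<le> q ^ ?K" using q by (intro power_increasing) auto
  then have qK: "q ^ ?K - 1 > 1" using q by (simp del: power_Suc)
  then have x1: "x > 1" unfolding x_def by (subst real_root_gt_1_iff) auto
  have xK: "x ^ ?K = q ^ ?K - 1" unfolding x_def using qK by (intro real_root_pow_pos2) auto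
  have xq: "x < q"
  proof (rule ccontr)
    assume "\<not> x < q"
    then have "q ^ ?K \<le> x ^ ?K" using q by (intro power_mono) auto
    then show False using xK by simp
  qed
  define D where "D = (\<Sum>k\<le>?K. real (card (avoiding u k)))"
  have D: "card (avoiding u n) \<le> D * x ^ n" for n
    unfolding D_def
  proof (rule geometric_bound_of_step)
    fix n :: nat assume "n > 0"
    have "real (card (avoiding u (n + ?K)))
            \<le> real (card (avoiding u n) * ((2 * CARD('x) - 1) ^ ?K - 1))"
      using card_avoiding_step[OF assms \<open>n > 0\<close>] by (simp only: of_nat_le_iff)
    also have "\<dots> = card (avoiding u n) * x ^ ?K"
      by (simp only: of_nat_mult of_nat_diff[OF one_le_power[OF q1]] of_nat_power q_nat xK of_nat_1)
    finally show "real (card (avoiding u (n + ?K))) \<le> card (avoiding u n) * x ^ ?K" .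
  qed (use x1 in auto)
  have D0: "D \<ge> 0" by (simp add: D_def sum_nonneg)
  \<comment> \<open>The factor \<open>x / (x - 1)\<close> comes from the geometric sum;
    \<open>D + 1\<close> replaces \<open>D\<close> to make the constant positive.\<close>
  have "card (\<Union>k\<le>n. avoiding u k) \<le> (D + 1) * x / (x - 1) * x ^ n" for n
  proof -
    have "real (card (\<Union>k\<le>n. avoiding u k)) \<le> (\<Sum>k\<le>n. real (card (avoiding u k)))"
      using card_UN_le[of "{..n}" "avoiding u"] by (simp flip: of_nat_sum)
    also have "\<dots> \<le> (\<Sum>k\<le>n. D * x ^ k)" by (intro sum_mono D)
    also have "\<dots> = D * ((x ^ Suc n - 1) / (x - 1))"
      using x1 geometric_sum[of x "Suc n"] by (simp flip: sum_distrib_left lessThan_Suc_atMost)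
    also have "\<dots> \<le> (D + 1) * (x ^ Suc n / (x - 1))"
      using D0 x1 one_le_power[of x "Suc n"]
      by (intro mult_mono divide_right_mono divide_nonneg_pos) (auto simp del: power_Suc)
    finally show ?thesis by (simp add: mult_ac)
  qed
  moreover have "(D + 1) * x / (x - 1) > 0" using D0 x1 by simp
  ultimately show ?thesis using that x1 xq unfolding q_def by blast
qed

subsection \<open>Growth of modules with a nonzero annihilator\<close>

lemma poly_mapping_eq_sum_single:
  "(a :: 'a \<Rightarrow>\<^sub>0 'b::comm_monoid_add) =
     (\<Sum>g\<in>Poly_Mapping.keys a. Poly_Mapping.single g (Poly_Mapping.lookup a g))"
  by (rule poly_mapping_eqI)
    (auto simp: lookup_sum lookup_single when_def in_keys_iff sum.delta)

context right_module
begin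

lemma act_0_left [simp]: "act 0 a = 0"
  using act_add_left[of 0 0 a] by simp

lemma act_0_right [simp]: "act m 0 = 0"
  using act_add_right[of m 0 0] by simp

lemma act_sum_right: "act m (\<Sum>i\<in>I. f i) = (\<Sum>i\<in>I. act m (f i))"
  by (induction I rule: infinite_finite_induct) (auto simp: act_add_right)

end

text \<open>The basis element with coefficient \<open>c\<close> factors as
  \<open>single g 1 * single 0 c\<close>, so the scalar acts last.\<close>

lemma act_single:
  assumes "right_module act"
  shows "act m (Poly_Mapping.single g c) = scalar act c (act m (Poly_Mapping.single g 1))"
proof -
  interpret right_module act by fact
  show ?thesis by (simp add: scalar_def mult_single flip: act_mult)
qed

text \<open>Here \<open>u\<close> is the leading word of \<open>a\<close>. If
  \<open>w = P @ u @ Q\<close>, the relation \<open>m p a q = 0\<close> can be solved for its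
  leading term \<open>m w\<close>, leaving smaller words, to which well-founded induction applies.
  Smaller words are not longer, whence the length bound.\<close>

lemma annihilator_avoiding_span:
  fixes act :: "'m::ab_group_add \<Rightarrow> ('x::finite, 'k::field) free_group_algebra \<Rightarrow> 'm"
  assumes mod: "right_module act" and a: "a \<in> annihilator act" "a \<noteq> 0"
  obtains u where "reduced u"
    "\<And>m g. act m (Poly_Mapping.single g 1) \<in> module.span (scalar act)
        ((\<lambda>w. act m (Poly_Mapping.single (Abs_free_group w) 1)) `
           (\<Union>k\<le>word_length g. avoiding u k))"
proof -
  interpret right_module act by fact
  interpret V: vector_space "scalar act" by (rule vector_space_scalar[OF mod])
  \<comment> \<open>Any total well-founded order of the letters will do: \<open>lenlex\<close>
    inherits totality, for the choice of a leading word, and well-foundedness, for the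
    induction.\<close>
  obtain f :: "'x letter \<Rightarrow> nat" where f: "inj f"
    using finite_imp_inj_to_nat_seg[of "UNIV :: 'x letter set"] by auto
  define R where "R = inv_image less_than f"
  have wfR: "wf R" and transR: "trans R" and irrR: "irrefl R" and totR: "total R"
    using inj_onD[OF f] unfolding R_def
    by (auto intro: trans_inv_image simp: irrefl_def total_on_def neq_iff[symmetric] simp del: split_paired_All)
  have lenlex_neq: "x \<noteq> y \<Longrightarrow> (x, y) \<in> lenlex R \<or> (y, x) \<in> lenlex R" for x y
    using total_lenlex[OF totR] by (auto simp: total_on_def)
  have keys: "finite (word_of ` Poly_Mapping.keys a)" "word_of ` Poly_Mapping.keys a \<noteq> {}"
    using a(2) by auto
  have "\<exists>u\<in>word_of ` Poly_Mapping.keys a.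
      \<forall>v\<in>word_of ` Poly_Mapping.keys a. v \<noteq> u \<longrightarrow> (v, u) \<in> lenlex R"
    by (rule Finite_Set.bex_greatest_element[OF keys])
       (use lenlex_neq lenlex_trans[OF _ _ transR] in \<open>unfold transp_on_def totalp_on_def, blast+\<close>)
  then obtain h where h: "h \<in> Poly_Mapping.keys a"
    and max: "\<And>g. g \<in> Poly_Mapping.keys a \<Longrightarrow> g \<noteq> h \<Longrightarrow> (word_of g, word_of h) \<in> lenlex R"
    by (auto simp: word_of_inject)
  define u where "u = word_of h"
  let ?b = "\<lambda>m w. act m (Poly_Mapping.single (Abs_free_group w) 1)"
  have main: "?b m w \<in> V.span (?b m ` (\<Union>k\<le>length w. avoiding u k))"
    if "reduced w" for m w
    using wf_lenlex[OF wfR] that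
  proof (induction w rule: wf_induct_rule)
    case (less w)
    show ?case
    proof (cases "sublist u w")
      case False
      then show ?thesis
        using less.prems by (intro V.span_base) (auto simp: avoiding_def)
    next
      case True
      then obtain P Q where w: "w = P @ u @ Q" by (auto simp: sublist_def)
      then have red: "reduced P" "reduced Q" "reduced u" "reduced (u @ Q)" "reduced (P @ u @ Q)"
        using less.prems by (auto simp: reduced_append_iff)
      define p q where "p = Abs_free_group P" and "q = Abs_free_group Q"
      have PQ: "word_of p = P" "word_of q = Q"
        using red by (simp_all add: p_def q_def word_of_Abs)
      have "word_of (p + (h + q)) = w"
        using red by (simp add: word_of_add PQ u_def[symmetric] foldr_push_reduced w)
      then have phq: "p + h + q = Abs_free_group w"
        by (metis word_of_inverse add.assoc)
      let ?s = "\<lambda>g. scalar act (Poly_Mapping.lookup a g)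
                      (act m (Poly_Mapping.single (p + g + q) 1))"
      let ?S = "V.span (?b m ` (\<Union>k\<le>length w. avoiding u k))"
      \<comment> \<open>The annihilator is a two-sided ideal: \<open>a\<close> kills every element
        of the module, in particular \<open>m p\<close>.\<close>
      have "act m (Poly_Mapping.single p 1 * a * Poly_Mapping.single q 1) = 0"
        using a(1) by (simp add: act_mult annihilator_def)
      also have "Poly_Mapping.single p 1 * a * Poly_Mapping.single q 1 =
          (\<Sum>g\<in>Poly_Mapping.keys a. Poly_Mapping.single (p + g + q) (Poly_Mapping.lookup a g))"
        by (subst poly_mapping_eq_sum_single[of a])
          (simp add: sum_distrib_left sum_distrib_right mult_single)
      also have "act m \<dots> = (\<Sum>g\<in>Poly_Mapping.keys a. ?s g)"
        by (simp add: act_sum_right act_single[OF mod, of m _ "Poly_Mapping.lookup a _"])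
      also have "\<dots> = ?s h + (\<Sum>g\<in>Poly_Mapping.keys a - {h}. ?s g)"
        using h by (intro sum.remove) auto
      finally have "?s h = - (\<Sum>g\<in>Poly_Mapping.keys a - {h}. ?s g)"
        by (simp add: add_eq_0_iff2)
      moreover have "(\<Sum>g\<in>Poly_Mapping.keys a - {h}. ?s g) \<in> ?S"
      proof (intro V.span_sum V.span_scale)
        fix g assume "g \<in> Poly_Mapping.keys a - {h}"
        then have less': "(word_of (p + g + q), w) \<in> lenlex R"
          using word_of_add3_less[OF max irrR, of g p q] by (simp add: PQ w u_def)
        have "?b m (word_of (p + g + q))
            \<in> V.span (?b m ` (\<Union>k\<le>length (word_of (p + g + q)). avoiding u k))"
          by (rule less.IH[OF less']) simp
        also have "\<dots> \<subseteq> ?S"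
          using lenlex_length[OF less'] by (intro V.span_mono image_mono UN_mono) auto
        finally show "act m (Poly_Mapping.single (p + g + q) 1) \<in> ?S"
          by (simp add: word_of_inverse)
      qed
      ultimately have "?s h \<in> ?S" by (simp add: V.span_neg)
      \<comment> \<open>The leading coefficient is nonzero, since \<open>h\<close> is a key of
        \<open>a\<close>, and can be divided out.\<close>
      then have "scalar act (inverse (Poly_Mapping.lookup a h)) (?s h) \<in> ?S"
        by (rule V.span_scale)
      then show ?thesis
        using h by (simp add: phq in_keys_iff)
    qed
  qed
  show ?thesis
  proof (rule that)
    show "reduced u" by (simp add: u_def)
    show "act m (Poly_Mapping.single g 1) \<in> V.span (?b m ` (\<Union>k\<le>word_length g. avoiding u k))"
      for m g
      using main[of "word_of g" m] by (simp add: word_length_def word_of_inverse)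
  qed
qed

text \<open>The products \<open>m w\<close> with \<open>m\<close> in \<open>A\<close> and
  \<open>w\<close> avoiding \<open>u\<close>, of length at most \<open>n\<close>, span a space
  containing \<open>A R(n)\<close>. As \<open>A\<close> is any finite set, the bound also covers
  generators of a proper submodule.\<close>

lemma growth_le_of_annihilator:
  fixes act :: "'m::ab_group_add \<Rightarrow> ('x::finite, 'k::field) free_group_algebra \<Rightarrow> 'm"
  assumes mod: "right_module act" and card: "CARD('x) > 1"
    and "\<not> faithful act" and A: "finite A"
  obtains C x :: real where "C > 0" "1 < x" "x < 2 * real CARD('x) - 1"
    "\<And>n. growth act A n \<le> C * x ^ n"
proof -
  interpret right_module act by fact
  interpret V: vector_space "scalar act" by (rule vector_space_scalar[OF mod])
  interpret W: vector_space "scalar ((*) :: ('x, 'k) free_group_algebra \<Rightarrow> _ \<Rightarrow> _)"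
    by (rule vector_space_scalar[OF right_module_regular])
  have "0 \<in> annihilator act" by (simp add: annihilator_def)
  then obtain a where "a \<in> annihilator act" "a \<noteq> 0"
    using assms(3) by (auto simp: faithful_def)
  then obtain u where u: "reduced u"
    "\<And>m g. act m (Poly_Mapping.single g 1) \<in> V.span
        ((\<lambda>w. act m (Poly_Mapping.single (Abs_free_group w) 1)) `
           (\<Union>k\<le>word_length g. avoiding u k))"
    using annihilator_avoiding_span[OF mod] by blast
  obtain C x :: real where Cx: "C > 0" "1 < x" "x < 2 * real CARD('x) - 1"
    "\<And>n. card (\<Union>k\<le>n. avoiding u k) \<le> C * x ^ n"
    using card_avoiding_bound[OF card u(1)] by blast
  have "growth act A n \<le> (real (card A) + 1) * C * x ^ n" for n
  proof -
    let ?N = "\<Union>k\<le>n. avoiding u k"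
    let ?b = "\<lambda>(m, w). act m (Poly_Mapping.single (Abs_free_group w) 1)"
    have "act m b \<in> V.span (?b ` (A \<times> ?N))" if m: "m \<in> A" and b: "b \<in> ball_span n" for m b
      using b unfolding ball_span_def
    proof (induction rule: W.span_induct_alt)
      case base
      then show ?case by (simp add: V.span_zero)
    next
      case (step c x y)
      then obtain g where g: "x = Poly_Mapping.single g 1" "word_length g \<le> n" by auto
      have "act m x \<in> V.span
          ((\<lambda>w. act m (Poly_Mapping.single (Abs_free_group w) 1)) `
             (\<Union>k\<le>word_length g. avoiding u k))"
        unfolding g(1) by (rule u(2))
      also have "\<dots> \<subseteq> V.span (?b ` (A \<times> ?N))"
        using m g(2) by (intro V.span_mono) force
      finally have "scalar act c (act m x) \<in> V.span (?b ` (A \<times> ?N))"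
        by (rule V.span_scale)
      moreover have "act m (scalar (*) c x) = scalar act c (act m x)"
        by (simp add: scalar_def act_mult)
      ultimately show ?case
        using step by (simp add: act_add_right V.span_add)
    qed
    then have "V.span {act m b | m b. m \<in> A \<and> b \<in> ball_span n} \<subseteq> V.span (?b ` (A \<times> ?N))"
      by (intro V.span_minimal V.subspace_span) auto
    moreover have fin: "finite (A \<times> ?N)" using A by simp
    ultimately have "growth act A n \<le> card (?b ` (A \<times> ?N))"
      unfolding growth_def by (intro V.dim_le_card) auto
    also have "\<dots> \<le> card (A \<times> ?N)" by (rule card_image_le[OF fin])
    finally have "real (growth act A n) \<le> card A * real (card ?N)"
      by (simp add: card_cartesian_product flip: of_nat_mult)
    \<comment> \<open>Adding 1 keeps the constant positive when \<open>A\<close> is empty.\<close>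
    also have "\<dots> \<le> (real (card A) + 1) * (C * x ^ n)"
      using Cx by (intro mult_mono Cx) auto
    finally show ?thesis by (simp add: mult_ac)
  qed
  moreover have "(real (card A) + 1) * C > 0" using Cx(1) by simp
  ultimately show ?thesis using that Cx(2,3) by blast
qed

subsection \<open>Growth of the free module of rank 1\<close>

lemma finite_free_group_ball: "finite {g :: 'x::finite free_group. word_length g \<le> n}"
proof (rule finite_subset)
  show "{g :: 'x free_group. word_length g \<le> n}
      \<subseteq> Abs_free_group ` {w. set w \<subseteq> UNIV \<and> length w \<le> n}"
    by (force simp: word_length_def word_of_inverse intro: image_eqI[of _ _ "word_of _"])
qed (intro finite_imageI finite_lists_length_le finite)

lemma card_free_group_ball_ge:
  "(2 * CARD('x::finite) - 1) ^ n \<le> card {g :: 'x free_group. word_length g \<le> n}"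
proof -
  have "w \<in> word_of ` {g. word_length g \<le> n}" if "length w = n" "reduced w" for w :: "'x letter list"
    using that by (intro image_eqI[of _ _ "Abs_free_group w"]) (auto simp: word_length_def word_of_Abs)
  then have "{w :: 'x letter list. length w = n \<and> reduced w} \<subseteq> word_of ` {g. word_length g \<le> n}"
    by blast
  then have "card {w :: 'x letter list. length w = n \<and> reduced w}
      \<le> card {g :: 'x free_group. word_length g \<le> n}"
    by (rule surj_card_le[OF finite_free_group_ball])
  then show ?thesis
    using card_reduced_words_ge order_trans by blast
qed

text \<open>Group elements are linearly independent in the group algebra, so the growth function
  counts the ball of radius \<open>n\<close>, which contains the sphere.\<close>

lemma growth_regular_ge:
  "(2 * CARD('x::finite) - 1) ^ n \<le>
     growth ((*) :: ('x, 'k::field) free_group_algebra \<Rightarrow> _ \<Rightarrow> _) {1} n"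
proof -
  let ?mult = "(*) :: ('x, 'k) free_group_algebra \<Rightarrow> _ \<Rightarrow> _"
  interpret W: vector_space "scalar ?mult"
    by (rule vector_space_scalar[OF right_module_regular])
  let ?s = "\<lambda>g. Poly_Mapping.single g 1 :: ('x, 'k) free_group_algebra"
  let ?B = "{g :: 'x free_group. word_length g \<le> n}"
  have inj: "inj_on ?s X" for X
    by (rule inj_onI) (metis lookup_single_eq lookup_single_not_eq zero_neq_one)
  have ind: "W.independent (?s ` ?B)"
  proof (rule W.independent_if_scalars_zero)
    show "finite (?s ` ?B)" by (intro finite_imageI finite_free_group_ball)
  next
    fix c y assume 0: "(\<Sum>x\<in>?s ` ?B. scalar ?mult (c x) x) = 0" and "y \<in> ?s ` ?B"
    then obtain h where h: "y = ?s h" "h \<in> ?B" by auto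
    \<comment> \<open>Reading off the coefficient at \<open>h\<close> isolates
      \<open>c y\<close>.\<close>
    have "0 = Poly_Mapping.lookup (\<Sum>x\<in>?s ` ?B. scalar ?mult (c x) x) h" using 0 by simp
    also have "\<dots> = (\<Sum>g\<in>?B. Poly_Mapping.lookup (scalar ?mult (c (?s g)) (?s g)) h)"
      by (subst sum.reindex[OF inj]) (simp add: lookup_sum)
    also have "\<dots> = (\<Sum>g\<in>?B. if g = h then c (?s h) else 0)"
      by (intro sum.cong) (auto simp: scalar_def mult_single lookup_single when_def)
    also have "\<dots> = c y"
      using h finite_free_group_ball[of n, where 'x='x] by (simp add: sum.delta)
    finally show "c y = 0" by simp
  qed
  \<comment> \<open>The span is doubled because \<open>1 * ball_span n\<close> is already a
    span.\<close>
  have "growth ?mult {1} n = W.dim (W.span (W.span (?s ` ?B)))"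
    unfolding growth_def ball_span_def by (simp add: setcompr_eq_image)
  then show ?thesis
    using card_free_group_ball_ge[of n, where 'x='x] ind
    by (simp add: W.dim_eq_card_independent card_image[OF inj])
qed

section \<open>Comparison of exponential rates\<close>

text \<open>The quotient is at least \<open>(1 / C) * (q / x) ^ n\<close>, and the
  \<open>n\<close>-th roots of this bound tend to \<open>q / x > 1\<close>, because those of a
  positive constant tend to 1.\<close>

lemma not_subexponential_ratio:
  fixes g :: "nat \<Rightarrow> nat" and C x q :: real
  assumes "C > 0" "1 < x" "x < q" "\<And>n. g n \<le> C * x ^ n"
  shows "\<not> subexponential (\<lambda>n. q ^ n / g n)"
proof
  assume sub: "subexponential (\<lambda>n. q ^ n / g n)"
  \<comment> \<open>A zero of \<open>g\<close> would make the quotient 0, against the positivity in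
    \<open>subexponential\<close>.\<close>
  have pos: "g n > 0" for n
    using sub assms(2,3) unfolding subexponential_def
    by (metis division_ring_divide_zero gr0I less_irrefl of_nat_0)
  have ge: "root n (1 / C) * (q / x) \<le> root n (q ^ n / g n)" if "n > 0" for n
  proof -
    have "(1 / C) * (q / x) ^ n \<le> q ^ n / g n"
      using assms pos[of n] by (simp add: power_divide divide_simps mult_ac mult_left_mono)
    then have "root n ((1 / C) * (q / x) ^ n) \<le> root n (q ^ n / g n)"
      using that by (simp add: real_root_le_iff)
    then show ?thesis
      using that assms by (subst (asm) real_root_mult) (simp add: real_root_power_cancel)
  qed
  have "(\<lambda>n. root n (1 / C) * (q / x)) \<longlonglongrightarrow> 1 * (q / x)"
    using assms by (intro tendsto_mult LIMSEQ_root_const tendsto_const) auto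
  then have "limsup (\<lambda>n. ereal (root n (1 / C) * (q / x))) = ereal (q / x)"
    by (intro lim_imp_Limsup) auto
  moreover have "limsup (\<lambda>n. ereal (root n (1 / C) * (q / x)))
      \<le> limsup (\<lambda>n. ereal (root n (q ^ n / g n)))"
    by (intro Limsup_mono eventually_mono[OF eventually_gt_at_top[of 0]]) (use ge in auto)
  ultimately have "ereal (q / x) \<le> 1"
    using sub order_trans by (metis subexponential_def)
  then show False using assms by simp
qed

theorem proposition9:
  fixes act :: "'m::ab_group_add \<Rightarrow> ('x::finite, 'k::field) free_group_algebra \<Rightarrow> 'm"
    and r :: nat
  assumes "r = CARD('x)" and "r > 1"
    and "right_module act"
  shows "(\<forall>A. finite A \<longrightarrow> generates act A UNIV \<longrightarrow>
            subexponential (\<lambda>n. (2 * real r - 1) ^ n / real (growth act A n)) \<longrightarrow>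
            faithful act)
         \<and> (maximal_growth act \<longrightarrow> faithful act)"
proof (intro conjI allI impI)
  have card: "CARD('x) > 1" using assms(1,2) by simp
  fix A
  assume A: "finite A"
    and sub: "subexponential (\<lambda>n. (2 * real r - 1) ^ n / real (growth act A n))"
  show "faithful act"
  proof (rule ccontr)
    assume "\<not> faithful act"
    then obtain C x :: real where "C > 0" "1 < x" "x < 2 * real r - 1"
      "\<And>n. growth act A n \<le> C * x ^ n"
      using growth_le_of_annihilator[OF assms(3) card _ A] unfolding assms(1) by blast
    then show False using not_subexponential_ratio sub by blast
  qed
next
  assume "maximal_growth act"
  then obtain A C' where A: "finite A"
    and C': "\<And>n. growth ((*) :: ('x, 'k) free_group_algebra \<Rightarrow> _ \<Rightarrow> _) {1} n
                    \<le> growth act A (n + C')"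
    unfolding maximal_growth_def fg_maximal_growth_def growth_equiv_def by blast
  show "faithful act"
  proof (rule ccontr)
    assume "\<not> faithful act"
    \<comment> \<open>\<open>A\<close> generates just a submodule, but the upper bound holds for
      every finite set of elements of the whole module.\<close>
    then obtain C x :: real where Cx: "C > 0" "1 < x" "x < 2 * real CARD('x) - 1"
      "\<And>n. growth act A n \<le> C * x ^ n"
      using growth_le_of_annihilator[OF assms(3) _ _ A] assms(1,2) by blast
    let ?q = "2 * real CARD('x) - 1"
    \<comment> \<open>The shift by \<open>C'\<close> costs only the constant factor
      \<open>x ^ C'\<close>, while the powers of \<open>?q / x > 1\<close> are unbounded.\<close>
    have "(?q / x) ^ n \<le> C * x ^ C'" for n
    proof -
      have "?q ^ n = real ((2 * CARD('x) - 1) ^ n)"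
        by (simp add: of_nat_diff)
      also have "\<dots> \<le> growth act A (n + C')"
        using order_trans[OF growth_regular_ge C'] by (simp only: of_nat_le_iff)
      also have "\<dots> \<le> C * x ^ (n + C')" by (rule Cx(4))
      finally show ?thesis
        using Cx(2) by (simp add: power_divide divide_simps power_add mult_ac)
    qed
    moreover obtain n where "C * x ^ C' < (?q / x) ^ n"
      using real_arch_pow[of "?q / x" "C * x ^ C'"] Cx by auto
    ultimately show False by (meson not_le)
  qed
qed

end
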